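(* Let $I = [0,R)$ for some $0 < R \leq \infty$, and let $f : I \to [0,\infty)$. Let $G$ be a tree with at least $3$ vertices, and let $A_3$ denote the path graph on $3$ vertices. Then the following are equivalent: (1) $f_G[A] \in \mathbb{P}_G$ for every $A \in \mathbb{P}_G(I)$; (2) $f_T[A] \in \mathbb{P}_T$ for all trees $T$ and all matrices $A \in \mathbb{P}_T(I)$; (3) $f_{A_3}[A] \in \mathbb{P}_{A_3}$ for every $A \in \mathbb{P}_{A_3}(I)$; (4) the function $f$ satisfies $$f(\sqrt{xy})^2 \leq f(x) f(y) \quad \text{for all } x,y \in I,$$ and $f$ is superadditive on $I$, i.e., $$f(x+y) \geq f(x) + f(y) \quad \text{whenever } x,\ y,\ x+y \in I.$$
   Context: All graphs $G=(V,E)$ are finite, undirected, with no self-loops, with vertex set $V=\{1,\dots,n\}$ and $|G|:=|V|$. For $I \subset \mathbb{R}$, $\mathbb{S}_n(I)$ is the set of real symmetric $n\times n$ matrices with entries in $I$, and $\mathbb{P}_n(I)$ is the set of positive semidefinite matrices in $\mathbb{S}_n(I)$. Define $\mathbb{S}_G(I) := \{A \in \mathbb{S}_{|G|}(I) : a_{ij} = 0 \text{ for every } (i,j)\notin E,\ i\neq j\}$ and $\mathbb{P}_G(I) := \mathbb{P}_{|G|}(I)\cap \mathbb{S}_G(I)$; write $\mathbb{P}_G := \mathbb{P}_G(\mathbb{R})$. For a function $f: I \to \mathbb{R}$ and $A\in \mathbb{S}_{|G|}(I)$, $f_G[A]$ is the matrix with $(i,j)$ entry $f(a_{ij})$ if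 $(i,j)\in E$ or $i=j$, and $0$ otherwise. *)

theory Defs
  imports
    "Jordan_Normal_Form.Matrix"
    "Graph_Theory.Graph_Theory"
    "HOL-Library.Extended_Real"
begin

text \<open>
  Graphs are symmetric, loop-free relations: an undirected edge joining \<open>i\<close> and \<open>j\<close> is the pair of
  arcs \<open>(i, j)\<close> and \<open>(j, i)\<close>.  Since matrices are indexed from \<open>0\<close>, the vertex set is
  \<open>{0, ..., n - 1}\<close> instead of \<open>{1, ..., n}\<close>.
\<close>

abbreviation graph_size :: "nat pair_pre_digraph \<Rightarrow> nat" where
  "graph_size G \<equiv> card (pverts G)"

definition labelled_graph :: "nat pair_pre_digraph \<Rightarrow> bool" where
  "labelled_graph G \<longleftrightarrow> pair_graph G \<and> pverts G = {0..<graph_size G}"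

text \<open>
  The library's \<^const>\<open>tree\<close> is meant for oriented trees: in a symmetric digraph
  every edge already gives a directed cycle of length 2.  The directed cycles of length at least 3
  are exactly the traversals of the cycles of the undirected graph.
  The null graph does not count as \<^const>\<open>Digraph_Component.connected\<close>.
\<close>

definition tree_graph :: "nat pair_pre_digraph \<Rightarrow> bool" where
  "tree_graph G \<longleftrightarrow> labelled_graph G \<and> Digraph_Component.connected (with_proj G) \<and>
     \<not> (\<exists>p. pre_digraph.cycle (with_proj G) p \<and> 3 \<le> length p)"

definition path_graph :: "nat \<Rightarrow> nat pair_pre_digraph" where
  "path_graph n = \<lparr> pverts = {0..<n},
     parcs = {(i, j). i < n \<and> j < n \<and> (j = Suc i \<or> i = Suc j)} \<rparr>"

definition sym_mats :: "nat \<Rightarrow> real set \<Rightarrow> real mat set" where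
  "sym_mats n I = {A \<in> carrier_mat n n. transpose_mat A = A \<and> elements_mat A \<subseteq> I}"

definition psd_mats :: "nat \<Rightarrow> real set \<Rightarrow> real mat set" where
  "psd_mats n I = {A \<in> sym_mats n I. \<forall>v \<in> carrier_vec n. 0 \<le> v \<bullet> (A *\<^sub>v v)}"

definition graph_sym_mats :: "nat pair_pre_digraph \<Rightarrow> real set \<Rightarrow> real mat set" where
  "graph_sym_mats G I = {A \<in> sym_mats (graph_size G) I.
     \<forall>i < graph_size G. \<forall>j < graph_size G. (i, j) \<notin> parcs G \<and> i \<noteq> j \<longrightarrow> A $$ (i, j) = 0}"

definition graph_psd_mats :: "nat pair_pre_digraph \<Rightarrow> real set \<Rightarrow> real mat set" where
  "graph_psd_mats G I = psd_mats (graph_size G) I \<inter> graph_sym_mats G I"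

definition graph_map_mat ::
    "nat pair_pre_digraph \<Rightarrow> (real \<Rightarrow> real) \<Rightarrow> real mat \<Rightarrow> real mat" where
  "graph_map_mat G f A = mat (graph_size G) (graph_size G)
     (\<lambda>(i, j). if (i, j) \<in> parcs G \<or> i = j then f (A $$ (i, j)) else 0)"

end

theory Submission
  imports Defs
begin

text \<open>
  Both conditions in (4) are what survives of positivity on very small vertex sets, and on a tree
  nothing more is needed, because positivity can be tested one leaf at a time.

  Sufficiency of (4).  Let \<open>v\<close> be a leaf hanging at \<open>u\<close>, and suppose \<open>a\<^sub>v\<^sub>u \<noteq> 0\<close>.  Eliminating \<open>v\<close>
  from \<open>A\<close> (Schur complement) alters a single entry: \<open>a\<^sub>u\<^sub>u\<close> becomes \<open>a\<^sub>u\<^sub>u - p\<close> with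
  \<open>p = a\<^sub>v\<^sub>u\<^sup>2 / a\<^sub>v\<^sub>v\<close>.  So \<open>A\<close> is the sum of a positive semidefinite matrix on the smaller graph and
  the rank-one block \<open>(a\<^sub>v\<^sub>v, a\<^sub>v\<^sub>u, p)\<close> on \<open>{v, u}\<close>.  Under \<open>f\<close> the smaller matrix stays positive
  by induction.  The block stays positive by the multiplicative condition, since
  \<open>a\<^sub>v\<^sub>u = sqrt (a\<^sub>v\<^sub>v p)\<close>.  The two pieces overlap only at \<open>(u, u)\<close>, where superadditivity gives
  \<open>f (a\<^sub>u\<^sub>u) \<ge> f (a\<^sub>u\<^sub>u - p) + f p\<close>.  This is \<open>entrywise_on_psd\<close>; its only demand on the graph is
  that every nonempty vertex set contains a vertex with at most one neighbour inside the set.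
  Graphs without cycles have this property (\<open>acyclic_leaf_eliminable\<close>), and for paths it is
  immediate (\<open>path_graph_leaf_eliminable\<close>).

  Necessity of (4).  A tree with at least three vertices contains an induced path \<open>a - c - b\<close>
  (\<open>tree_graph_has_cherry\<close>), and so does the path on three vertices.  Two test matrices supported
  on it suffice (\<open>necessary_from_cherry\<close>): the rank-one matrix with entries \<open>x, sqrt (x y), y\<close> on
  \<open>{c, a}\<close> gives the multiplicative condition, and the sum of the two blocks with all entries \<open>x\<close> on
  \<open>{c, a}\<close> and all entries \<open>y\<close> on \<open>{c, b}\<close> gives superadditivity.
\<close>

section \<open>Positive semidefinite kernels on finite sets\<close>

definition quad_form :: "'a set \<Rightarrow> ('a \<Rightarrow> 'a \<Rightarrow> real) \<Rightarrow> ('a \<Rightarrow> real) \<Rightarrow> real" where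
  "quad_form W a z = (\<Sum>i\<in>W. \<Sum>j\<in>W. z i * a i j * z j)"

definition psd_on :: "'a set \<Rightarrow> ('a \<Rightarrow> 'a \<Rightarrow> real) \<Rightarrow> bool" where
  "psd_on W a \<longleftrightarrow> (\<forall>z. 0 \<le> quad_form W a z)"

lemma quad_form_supported:
  assumes "finite W" "S \<subseteq> W"
    and "\<And>i j. i \<in> W \<Longrightarrow> j \<in> W \<Longrightarrow> i \<notin> S \<or> j \<notin> S \<Longrightarrow> z i * a i j * z j = 0"
  shows "quad_form W a z = quad_form S a z"
proof -
  have "quad_form W a z = (\<Sum>i\<in>S. \<Sum>j\<in>W. z i * a i j * z j)"
    unfolding quad_form_def using assms by (intro sum.mono_neutral_right ballI sum.neutral) auto
  also have "\<dots> = quad_form S a z"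
    unfolding quad_form_def using assms
    by (intro sum.cong refl sum.mono_neutral_right) auto
  finally show ?thesis .
qed

lemma quad_form_cong:
  assumes "\<And>i j. i \<in> W \<Longrightarrow> j \<in> W \<Longrightarrow> a i j = b i j" "\<And>i. i \<in> W \<Longrightarrow> z i = y i"
  shows "quad_form W a z = quad_form W b y"
  unfolding quad_form_def using assms by (intro sum.cong refl) auto

lemma psd_on_cong:
  assumes "\<And>i j. i \<in> W \<Longrightarrow> j \<in> W \<Longrightarrow> a i j = b i j"
  shows "psd_on W a \<longleftrightarrow> psd_on W b"
  using quad_form_cong[of W a b, OF assms] by (simp add: psd_on_def)

lemma psd_on_subset:
  assumes "psd_on W a" "finite W" "S \<subseteq> W"
  shows "psd_on S a"
  unfolding psd_on_def
proof
  fix z :: "'a \<Rightarrow> real"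
  let ?y = "\<lambda>i. if i \<in> S then z i else 0"
  have "quad_form W a ?y = quad_form S a ?y"
    using assms by (intro quad_form_supported) auto
  also have "\<dots> = quad_form S a z"
    by (intro quad_form_cong) auto
  finally show "0 \<le> quad_form S a z"
    using assms(1) unfolding psd_on_def by metis
qed

lemma quad_form_insert:
  assumes "finite W" "v \<notin> W" and sym: "\<And>i. i \<in> W \<Longrightarrow> a i v = a v i"
  shows "quad_form (insert v W) a z
    = a v v * (z v)\<^sup>2 + 2 * z v * (\<Sum>j\<in>W. a v j * z j) + quad_form W a z"
proof -
  have "(\<Sum>i\<in>W. z i * a i v * z v) = z v * (\<Sum>j\<in>W. a v j * z j)"
    unfolding sum_distrib_left using sym by (intro sum.cong) auto
  then show ?thesis
    using assms(1,2)
    by (simp add: quad_form_def sum.distrib sum_distrib_left power2_eq_square algebra_simps)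
qed

lemma quad_form_change_diagonal:
  assumes "finite W" "u \<in> W"
  shows "quad_form W (\<lambda>i j. if i = u \<and> j = u then t else a i j) z
    = quad_form W a z + (t - a u u) * (z u)\<^sup>2"
proof -
  have "quad_form W (\<lambda>i j. if i = u \<and> j = u then t else a i j) z
    = (\<Sum>i\<in>W. \<Sum>j\<in>W. z i * a i j * z j
        + (if j = u then if i = u then (t - a u u) * (z u)\<^sup>2 else 0 else 0))"
    unfolding quad_form_def
    by (intro sum.cong refl) (auto simp: power2_eq_square algebra_simps)
  also have "\<dots> = quad_form W a z + (t - a u u) * (z u)\<^sup>2"
    using assms by (simp add: quad_form_def sum.distrib)
  finally show ?thesis .
qed

text \<open>
  Completing the square.  Both directions serve: (4) enters as the right-hand side, and the
  positivity of a two-by-two block is used as the left-hand side.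
\<close>

lemma binary_form_nonneg_iff:
  fixes p q r :: real
  shows "(\<forall>x y. 0 \<le> p * x\<^sup>2 + 2 * q * x * y + r * y\<^sup>2)
    \<longleftrightarrow> 0 \<le> p \<and> 0 \<le> r \<and> q\<^sup>2 \<le> p * r" (is "?L \<longleftrightarrow> ?R")
proof
  assume L: ?L
  have "0 \<le> p" "0 \<le> r"
    using L[rule_format, of 1 0] L[rule_format, of 0 1] by auto
  moreover have "q\<^sup>2 \<le> p * r"
  proof (cases "p = 0")
    case True
    have "q = 0"
    proof (rule ccontr)
      assume "q \<noteq> 0"
      then show False
        using L[rule_format, of "- (r + 1) / (2 * q)" 1] True by (simp add: field_simps)
    qed
    then show ?thesis using True by simp
  next
    case False
    with \<open>0 \<le> p\<close> have "0 < p" by simp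
    have "0 \<le> p * (- q / p)\<^sup>2 + 2 * q * (- q / p) * 1 + r * 1\<^sup>2"
      using L by blast
    then show ?thesis
      using \<open>0 < p\<close> by (simp add: field_simps power2_eq_square)
  qed
  ultimately show ?R by simp
next
  assume R: ?R
  show ?L
  proof (intro allI)
    fix x y
    show "0 \<le> p * x\<^sup>2 + 2 * q * x * y + r * y\<^sup>2"
    proof (cases "p = 0")
      case True
      then show ?thesis using R by simp
    next
      case False
      have "p * (p * x\<^sup>2 + 2 * q * x * y + r * y\<^sup>2)
        = (p * x + q * y)\<^sup>2 + (p * r - q\<^sup>2) * y\<^sup>2"
        by (simp add: power2_eq_square algebra_simps)
      also have "\<dots> \<ge> 0" using R by simp
      finally show ?thesis using False R by (simp add: zero_le_mult_iff)
    qed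
  qed
qed

text \<open>
  The two-by-two principal minor.  It forces \<open>a v u = 0\<close> when \<open>a v v = 0\<close>, so that a leaf with a nonzero
  entry can always serve as a pivot, and it bounds the Schur correction by \<open>a u u\<close>.
\<close>

lemma psd_on_two_points:
  assumes "psd_on W a" "finite W" "u \<in> W" "v \<in> W" "u \<noteq> v" "a u v = a v u"
  shows "(a v u)\<^sup>2 \<le> a v v * a u u"
proof -
  have psd: "psd_on {v, u} a"
    using assms by (intro psd_on_subset[OF assms(1,2)]) auto
  have "0 \<le> a v v * x\<^sup>2 + 2 * a v u * x * y + a u u * y\<^sup>2" for x y
  proof -
    have "0 \<le> quad_form {v, u} a (\<lambda>i. if i = v then x else y)"
      using psd by (simp add: psd_on_def)
    then show ?thesis
      using assms(5,6) by (simp add: quad_form_def power2_eq_square algebra_simps)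
  qed
  then show ?thesis
    using binary_form_nonneg_iff by blast
qed

section \<open>Entrywise functions and leaf elimination\<close>

definition entrywise_on :: "'a rel \<Rightarrow> (real \<Rightarrow> real) \<Rightarrow> ('a \<Rightarrow> 'a \<Rightarrow> real) \<Rightarrow> 'a \<Rightarrow> 'a \<Rightarrow> real" where
  "entrywise_on E f a i j = (if (i, j) \<in> E \<or> i = j then f (a i j) else 0)"

text \<open>
  Isolated vertices count as leaves, so that forests and not just trees can be dismantled.
\<close>

definition leaf_in :: "'a rel \<Rightarrow> 'a set \<Rightarrow> 'a \<Rightarrow> bool" where
  "leaf_in E W v \<longleftrightarrow> v \<in> W \<and> (\<forall>u\<in>W. \<forall>w\<in>W. (v, u) \<in> E \<and> (v, w) \<in> E \<longrightarrow> u = w)"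

text \<open>
  This is 1-degeneracy.  Quantifying over all subsets, instead of asking for one elimination order,
  makes the property visibly hereditary.
\<close>

definition leaf_eliminable :: "'a rel \<Rightarrow> 'a set \<Rightarrow> bool" where
  "leaf_eliminable E V \<longleftrightarrow> (\<forall>W\<subseteq>V. W \<noteq> {} \<longrightarrow> (\<exists>v. leaf_in E W v))"

text \<open>
  Induction on \<open>W\<close>, eliminating a leaf \<open>v\<close>.  If the row of \<open>v\<close> vanishes off the diagonal, it still does
  so after applying \<open>f\<close>, because superadditivity and nonnegativity force \<open>f 0 = 0\<close>.  Otherwise
  the only nonzero off-diagonal entry of this row is at the neighbour \<open>u\<close>, and the Schur complement
  \<open>b\<close> of the entry at \<open>(v, v)\<close> is again a positive semidefinite kernel with values in \<open>I\<close> that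
  vanishes outside the diagonal and \<open>E\<close>.
\<close>

lemma entrywise_on_psd:
  fixes I :: "real set" and f :: "real \<Rightarrow> real"
  assumes I: "I \<subseteq> {0..}" "\<forall>x\<in>I. {0..x} \<subseteq> I"
    and f_nonneg: "\<forall>x\<in>I. 0 \<le> f x"
    and f_mult: "\<forall>x\<in>I. \<forall>y\<in>I. (f (sqrt (x * y)))\<^sup>2 \<le> f x * f y"
    and f_super: "\<forall>x\<in>I. \<forall>y\<in>I. x + y \<in> I \<longrightarrow> f x + f y \<le> f (x + y)"
    and E: "sym E"
    and W: "finite W" "leaf_eliminable E W"
    and a_sym: "\<And>i j. i \<in> W \<Longrightarrow> j \<in> W \<Longrightarrow> a i j = a j i"
    and a_I: "\<And>i j. i \<in> W \<Longrightarrow> j \<in> W \<Longrightarrow> a i j \<in> I"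
    and a_E: "\<And>i j. i \<in> W \<Longrightarrow> j \<in> W \<Longrightarrow> (i, j) \<notin> E \<Longrightarrow> i \<noteq> j \<Longrightarrow> a i j = 0"
    and psd: "psd_on W a"
  shows "psd_on W (entrywise_on E f a)"
  using W a_sym a_I a_E psd
proof (induction W arbitrary: a rule: finite_psubset_induct)
  case (psubset W)
  note f_nonneg = f_nonneg[rule_format] and f_mult = f_mult[rule_format]
    and f_super = f_super[rule_format]
  have I_nonneg: "0 \<le> x" if "x \<in> I" for x
    using I(1) that by auto
  have I_down: "y \<in> I" if "x \<in> I" "0 \<le> y" "y \<le> x" for x y
    using I(2) that by (meson atLeastAtMost_iff subsetD)
  note sym = psubset.prems(2) and inI = psubset.prems(3) and supp = psubset.prems(4)
    and psd = psubset.prems(5)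
  show ?case
  proof (cases "W = {}")
    case True
    then show ?thesis by (simp add: psd_on_def quad_form_def)
  next
    case False
    then obtain v where leaf: "leaf_in E W v"
      using psubset.prems(1) by (auto simp: leaf_eliminable_def)
    define W' where "W' = W - {v}"
    have v: "v \<in> W" using leaf by (simp add: leaf_in_def)
    have W: "W = insert v W'" "v \<notin> W'" "finite W'" "W' \<subset> W" "W' \<subseteq> W"
      using v psubset.hyps by (auto simp: W'_def)
    have W'D: "i \<in> W" if "i \<in> W'" for i
      using that by (simp add: W'_def)
    have elim: "leaf_eliminable E W'"
      using psubset.prems(1) W by (auto simp: leaf_eliminable_def)
    let ?fa = "entrywise_on E f a"
    have fa_sym: "?fa i j = ?fa j i" if "i \<in> W" "j \<in> W" for i j
      using sym[OF that] E by (auto simp: entrywise_on_def dest: symD)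
    have f0: "f 0 = 0"
    proof -
      have "0 \<in> I" using inI[OF v v] I_nonneg I_down by blast
      then show ?thesis using f_nonneg[of 0] f_super[of 0 0] by simp
    qed
    have split: "quad_form W b z = b v v * (z v)\<^sup>2 + 2 * z v * (\<Sum>j\<in>W'. b v j * z j)
        + quad_form W' b z" if "\<And>i. i \<in> W' \<Longrightarrow> b i v = b v i" for b z
      using quad_form_insert[of W' v b z] W that by simp
    have a_nonneg: "0 \<le> a v v" "0 \<le> f (a v v)"
      using inI v I_nonneg f_nonneg by auto
    show ?thesis
    proof (cases "\<exists>u\<in>W'. a v u \<noteq> 0")
      case False
      have "psd_on W' ?fa"
      proof (rule psubset.IH[OF W(4) elim])
        show "psd_on W' a"
          by (rule psd_on_subset[OF psd psubset.hyps(1) W(5)])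
      qed (simp_all add: W'D sym inI supp)
      moreover have "(\<Sum>j\<in>W'. ?fa v j * z j) = 0" for z
        using False W(2) f0 by (intro sum.neutral) (auto simp: entrywise_on_def)
      ultimately have "0 \<le> quad_form W ?fa z" for z
        using split[of ?fa z] fa_sym[OF W'D v] a_nonneg(2)
        by (simp add: psd_on_def entrywise_on_def[of E f a v v])
      then show ?thesis
        by (simp add: psd_on_def)
    next
      case True
      then obtain u where u: "u \<in> W'" "a v u \<noteq> 0" by blast
      then have uW: "u \<in> W" "u \<noteq> v" using W by auto
      have vu: "(v, u) \<in> E" using supp[OF v uW(1)] u(2) uW(2) by auto
      have other: "(v, j) \<notin> E" if "j \<in> W'" "j \<noteq> u" for j
        using leaf vu that uW W(5) unfolding leaf_in_def by blast
      have row: "(\<Sum>j\<in>W'. b j * z j) = b u * z u"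
        if "\<And>j. j \<in> W' \<Longrightarrow> j \<noteq> u \<Longrightarrow> b j = 0" for b z :: "_ \<Rightarrow> real"
        using that u(1) W(3) by (subst sum.remove[of _ u]) auto
      have minor: "(a v u)\<^sup>2 \<le> a v v * a u u"
        using psd_on_two_points[OF psd psubset.hyps(1) uW(1) v uW(2)] sym[OF uW(1) v] by blast
      have "a v v \<noteq> 0" using minor u(2) by auto
      with a_nonneg have avv: "0 < a v v" by simp
      define p where "p = (a v u)\<^sup>2 / a v v"
      have p: "0 \<le> p" "p \<le> a u u"
        using minor avv by (auto simp: p_def field_simps)
      have auu: "a u u \<in> I" using inI uW by blast
      have pI: "p \<in> I" "a u u - p \<in> I"
        using p I_down[OF auu] by auto
      define b where "b = (\<lambda>i j. if i = u \<and> j = u then a u u - p else a i j)"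
      have qb: "quad_form W' b z = quad_form W' a z - p * (z u)\<^sup>2" for z
        unfolding b_def using quad_form_change_diagonal[OF W(3) u(1)] by simp
      have "psd_on W' b"
        unfolding psd_on_def
      proof
        fix z
        \<comment> \<open>This value at \<open>v\<close> minimises the form of \<open>a\<close>; the minimum is the form of \<open>b\<close>.\<close>
        let ?t = "- a v u * z u / a v v"
        let ?z = "z(v := ?t)"
        have "0 \<le> quad_form W a ?z"
          using psd by (simp add: psd_on_def)
        also have "quad_form W a ?z
            = a v v * ?t\<^sup>2 + 2 * ?t * (a v u * z u) + quad_form W' a ?z"
        proof -
          have "(\<Sum>j\<in>W'. a v j * ?z j) = a v u * ?z u"
            using other supp[OF v W'D] W(2) by (intro row) auto
          then show ?thesis
            using split[of a ?z] sym[OF W'D v] uW by simp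
        qed
        also have "quad_form W' a ?z = quad_form W' a z"
          using W(2) by (intro quad_form_cong) auto
        also have "a v v * ?t\<^sup>2 + 2 * ?t * (a v u * z u) = - (p * (z u)\<^sup>2)"
          using avv by (simp add: p_def field_simps power2_eq_square)
        finally show "0 \<le> quad_form W' b z"
          by (simp add: qb)
      qed
      then have IH: "psd_on W' (entrywise_on E f b)"
        using pI by (intro psubset.IH[OF W(4) elim]) (auto simp: b_def W'D sym inI supp)
      have schwarz: "(f (a v u))\<^sup>2 \<le> f (a v v) * f p"
      proof -
        have "a v v * p = (a v u)\<^sup>2" using avv by (simp add: p_def)
        then have "sqrt (a v v * p) = a v u" using inI[OF v uW(1)] I_nonneg by simp
        then show ?thesis using f_mult[OF inI[OF v v] pI(1)] by simp
      qed
      have super: "f (a u u - p) + f p \<le> f (a u u)"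
        using f_super[of "a u u - p" p] pI auu by simp
      show ?thesis
        unfolding psd_on_def
      proof
        fix z
        have fb: "entrywise_on E f b
            = (\<lambda>i j. if i = u \<and> j = u then f (a u u - p) else ?fa i j)"
          by (auto simp: fun_eq_iff entrywise_on_def b_def)
        have "0 \<le> quad_form W' (entrywise_on E f b) z"
          using IH by (simp add: psd_on_def)
        also have "\<dots> = quad_form W' ?fa z - (f (a u u) - f (a u u - p)) * (z u)\<^sup>2"
          unfolding fb using quad_form_change_diagonal[OF W(3) u(1), of "f (a u u - p)" ?fa z]
          by (simp add: entrywise_on_def algebra_simps)
        also have "\<dots> \<le> quad_form W' ?fa z - f p * (z u)\<^sup>2"
          using super by (simp add: mult_right_mono)
        finally have 1: "f p * (z u)\<^sup>2 \<le> quad_form W' ?fa z" by simp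
        have "0 \<le> f (a v v) * (z v)\<^sup>2 + 2 * f (a v u) * z v * z u + f p * (z u)\<^sup>2"
          using schwarz a_nonneg f_nonneg[OF pI(1)] binary_form_nonneg_iff by blast
        also have "\<dots> \<le> f (a v v) * (z v)\<^sup>2 + 2 * f (a v u) * z v * z u + quad_form W' ?fa z"
          using 1 by simp
        also have "\<dots> = quad_form W ?fa z"
        proof -
          have "(\<Sum>j\<in>W'. ?fa v j * z j) = ?fa v u * z u"
            using other W(2) by (intro row) (auto simp: entrywise_on_def)
          then show ?thesis
            using split[of ?fa z] fa_sym[OF W'D v] vu by (simp add: entrywise_on_def mult.assoc)
        qed
        finally show "0 \<le> quad_form W ?fa z" .
      qed
    qed
  qed
qed

section \<open>Cycles, leaves and cherries\<close>

text \<open>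
  A cyclic list of distinct adjacent vertices yields a cycle in the sense of arc walks.  The walk
  starts at \<open>last xs\<close>, since cycles are required to be distinct after their first vertex.
\<close>

lemma cycle_through_vertices:
  fixes G :: "'a pair_pre_digraph"
  assumes "xs \<noteq> []" "distinct xs" "last xs \<in> pverts G"
    and "set (vwalk_arcs (last xs # xs)) \<subseteq> parcs G"
  shows "pre_digraph.cycle (with_proj G) (vwalk_arcs (last xs # xs))"
proof -
  have cas: "pcas u (vwalk_arcs (u # ys)) (last (u # ys))" for u :: 'a and ys
    by (induction ys arbitrary: u) auto
  have verts: "pawalk_verts u (vwalk_arcs (u # ys)) = u # ys" for u :: 'a and ys
    by (induction ys arbitrary: u) auto
  have "vwalk_arcs (last xs # xs) \<noteq> []"
    using assms(1) by simp
  then show ?thesis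
    using cas[of "last xs" xs] verts[of "last xs" xs] assms
    unfolding pre_digraph.cycle_def pre_digraph.awalk_def
      cas_with_proj_eq awalk_verts_with_proj_eq with_proj_simps
    by (intro exI[of _ "last xs"]) (simp del: vwalk_arcs_Cons)
qed

text \<open>
  The first vertex \<open>x\<close> of a longest path in \<open>W\<close> has all its neighbours in \<open>W\<close> on that path.  A neighbour \<open>y\<close>
  other than the successor of \<open>x\<close> would close a cycle with at least three vertices.
\<close>

lemma acyclic_leaf_eliminable:
  assumes G: "pair_graph G"
    and acyclic: "\<not> (\<exists>p. pre_digraph.cycle (with_proj G) p \<and> 3 \<le> length p)"
  shows "leaf_eliminable (parcs G) (pverts G)"
  unfolding leaf_eliminable_def
proof (intro allI impI)
  fix W assume W: "W \<subseteq> pverts G" "W \<noteq> {}"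
  interpret pair_graph G by (rule G)
  have fin: "finite W" using W(1) pair_finite_verts finite_subset by blast
  define path where "path xs \<longleftrightarrow> xs \<noteq> [] \<and> distinct xs \<and> set xs \<subseteq> W
    \<and> set (vwalk_arcs xs) \<subseteq> parcs G" for xs
  obtain w where "w \<in> W" using W(2) by blast
  then have "path [w]" by (simp add: path_def)
  moreover have "length xs < Suc (card W)" if "path xs" for xs
    using that fin card_mono[of W "set xs"] by (auto simp: path_def distinct_card)
  ultimately obtain xs where xs: "path xs" and longest: "\<And>ys. path ys \<Longrightarrow> length ys \<le> length xs"
    using ex_has_greatest_nat[of path "[w]" length "Suc (card W)"] by (metis less_imp_le)
  obtain x xs' where xs_eq: "xs = x # xs'" using xs by (cases xs) (auto simp: path_def)
  have "leaf_in (parcs G) W x"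
    unfolding leaf_in_def
  proof (intro conjI ballI impI)
    show "x \<in> W" using xs xs_eq by (auto simp: path_def)
    have only: "xs' \<noteq> [] \<and> y = hd xs'" if y: "y \<in> W" "(x, y) \<in> parcs G" for y
    proof (rule ccontr)
      assume far: "\<not> (xs' \<noteq> [] \<and> y = hd xs')"
      have yx: "(y, x) \<in> parcs G" using y(2) arcs_symmetric by blast
      have "y \<noteq> x" using y(2) no_loops' by blast
      have "y \<in> set xs"
      proof (rule ccontr)
        assume "y \<notin> set xs"
        then have "path (y # xs)"
          using xs y(1) yx by (auto simp: path_def xs_eq)
        then show False using longest by fastforce
      qed
      then have "y \<in> set xs'" using \<open>y \<noteq> x\<close> xs_eq by auto
      then obtain ys zs where split: "xs' = ys @ y # zs" by (auto simp: in_set_conv_decomp)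
      have "ys \<noteq> []" using far split by (cases ys) auto
      let ?c = "x # ys @ [y]"
      have "xs = ?c @ zs" using split xs_eq by simp
      then have "set (vwalk_arcs ?c) \<subseteq> parcs G" "distinct ?c"
        using xs set_vwalk_arcs_append1[of ?c zs] by (auto simp: path_def simp del: vwalk_arcs_Cons)
      then have "pre_digraph.cycle (with_proj G) (vwalk_arcs (last ?c # ?c))"
        using yx y(1) W(1) by (intro cycle_through_vertices) (auto simp del: append_Cons)
      moreover have "3 \<le> length (vwalk_arcs (last ?c # ?c))"
        using vwalk_length_simp[of "last ?c # ?c"] \<open>ys \<noteq> []\<close>
        unfolding vwalk_length_def by (cases ys) (auto simp del: vwalk_arcs_Cons)
      ultimately show False using acyclic by blast
    qed
    fix u w assume "u \<in> W" "w \<in> W" "(x, u) \<in> parcs G \<and> (x, w) \<in> parcs G"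
    then show "u = w" using only by blast
  qed
  then show "\<exists>v. leaf_in (parcs G) W v" ..
qed

text \<open>
  An induced path on three vertices with centre \<open>c\<close>.
\<close>

definition cherry :: "'a rel \<Rightarrow> 'a \<Rightarrow> 'a \<Rightarrow> 'a \<Rightarrow> bool" where
  "cherry E c a b \<longleftrightarrow> distinct [c, a, b] \<and> (c, a) \<in> E \<and> (c, b) \<in> E \<and> (a, b) \<notin> E"

text \<open>
  If no vertex had two neighbours, a vertex \<open>u\<close> and its at most one neighbour would be closed under
  adjacency, and connectedness would leave at most two vertices.  The two neighbours found are not
  adjacent, since a triangle is a cycle of length 3.
\<close>

lemma tree_graph_has_cherry:
  assumes T: "tree_graph G" and size: "3 \<le> graph_size G"
  shows "\<exists>c a b. cherry (parcs G) c a b"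
proof -
  have "pair_graph G" using T by (simp add: tree_graph_def labelled_graph_def)
  then interpret pair_graph G .
  have acyclic: "\<not> (\<exists>p. pre_digraph.cycle (with_proj G) p \<and> 3 \<le> length p)"
    using T by (simp add: tree_graph_def)
  have "\<exists>c a b. (c, a) \<in> parcs G \<and> (c, b) \<in> parcs G \<and> a \<noteq> b"
  proof (rule ccontr)
    assume no: "\<not> ?thesis"
    have "pverts G \<noteq> {}" using size by auto
    then obtain u where u: "u \<in> pverts G" by blast
    let ?S = "insert u {w. (u, w) \<in> parcs G}"
    have closed: "y \<in> ?S" if "x \<in> ?S" "(x, y) \<in> parcs G" for x y
      using that no arcs_symmetric by blast
    have eq: "parcs (mk_symmetric (with_proj G)) = parcs G"
      using adj_mk_symmetric_eq pair_sym_arcs by simp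
    have "pverts G \<subseteq> ?S"
    proof
      fix w assume "w \<in> pverts G"
      then have "u \<rightarrow>\<^sup>*\<^bsub>with_proj (mk_symmetric (with_proj G))\<^esub> w"
        using T u by (auto simp: tree_graph_def connected_def strongly_connected_def)
      then have "(u, w) \<in> rtrancl_on (pverts G) (parcs G)"
        unfolding reachable_def by (simp add: eq)
      then show "w \<in> ?S"
        by (induction rule: rtrancl_on_induct) (use closed in blast)+
    qed
    moreover have "finite ?S" "card ?S \<le> 2"
    proof -
      obtain w where "{w. (u, w) \<in> parcs G} \<subseteq> {w}" using no by blast
      then have S: "?S \<subseteq> {u, w}" by blast
      then show "finite ?S" by (rule finite_subset) simp
      show "card ?S \<le> 2" using card_mono[OF _ S] by (simp add: card_insert_if split: if_splits)
    qed
    ultimately show False using size card_mono[of ?S "pverts G"] by linarith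
  qed
  then obtain c a b where cab: "(c, a) \<in> parcs G" "(c, b) \<in> parcs G" "a \<noteq> b" by blast
  then have dist: "c \<noteq> a" "c \<noteq> b" using no_loops' by blast+
  have "(a, b) \<notin> parcs G"
  proof
    assume ab: "(a, b) \<in> parcs G"
    have "pre_digraph.cycle (with_proj G) (vwalk_arcs (last [a, b, c] # [a, b, c]))"
      using cab dist ab arcs_symmetric in_arcsD1 by (intro cycle_through_vertices) auto
    then show False using acyclic by force
  qed
  then show ?thesis using cab dist unfolding cherry_def by auto
qed

text \<open>
  The least vertex of \<open>W\<close> can only be adjacent to its successor.
\<close>

lemma path_graph_leaf_eliminable: "leaf_eliminable (parcs (path_graph n)) (pverts (path_graph n))"
  unfolding leaf_eliminable_def
proof (intro allI impI)
  fix W assume W: "W \<subseteq> pverts (path_graph n)" "W \<noteq> {}"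
  define m where "m = (LEAST i. i \<in> W)"
  have m: "m \<in> W" "\<And>i. i \<in> W \<Longrightarrow> m \<le> i"
    using W(2) by (auto simp: m_def intro: LeastI Least_le)
  have "u = Suc m" if "u \<in> W" "(m, u) \<in> parcs (path_graph n)" for u
    using that m(2)[OF that(1)] by (auto simp: path_graph_def)
  then show "\<exists>v. leaf_in (parcs (path_graph n)) W v"
    using m(1) by (auto simp: leaf_in_def intro!: exI[of _ m])
qed

section \<open>Matrices as kernels\<close>

lemma graph_psd_mats_iff:
  "A \<in> graph_psd_mats G I \<longleftrightarrow> A \<in> carrier_mat (graph_size G) (graph_size G)
    \<and> (\<forall>i<graph_size G. \<forall>j<graph_size G. A $$ (i, j) = A $$ (j, i) \<and> A $$ (i, j) \<in> I
        \<and> ((i, j) \<notin> parcs G \<and> i \<noteq> j \<longrightarrow> A $$ (i, j) = 0))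
    \<and> psd_on {0..<graph_size G} (\<lambda>i j. A $$ (i, j))"
proof (cases "A \<in> carrier_mat (graph_size G) (graph_size G)")
  case False
  then show ?thesis by (simp add: graph_psd_mats_def psd_mats_def sym_mats_def)
next
  case A: True
  let ?n = "graph_size G"
  have sym: "transpose_mat A = A \<longleftrightarrow> (\<forall>i<?n. \<forall>j<?n. A $$ (i, j) = A $$ (j, i))"
    using A by (auto simp: mat_eq_iff)
  have elems: "elements_mat A \<subseteq> I \<longleftrightarrow> (\<forall>i<?n. \<forall>j<?n. A $$ (i, j) \<in> I)"
    using A unfolding elements_mat_def by fastforce
  have form: "v \<bullet> (A *\<^sub>v v) = quad_form {0..<?n} (\<lambda>i j. A $$ (i, j)) (\<lambda>i. v $ i)"
    if "v \<in> carrier_vec ?n" for v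
    using A that
    by (auto simp: scalar_prod_def quad_form_def sum_distrib_left mult.assoc intro!: sum.cong)
  have "(\<forall>v \<in> carrier_vec ?n. 0 \<le> v \<bullet> (A *\<^sub>v v)) \<longleftrightarrow> psd_on {0..<?n} (\<lambda>i j. A $$ (i, j))"
  proof
    assume L: "\<forall>v \<in> carrier_vec ?n. 0 \<le> v \<bullet> (A *\<^sub>v v)"
    show "psd_on {0..<?n} (\<lambda>i j. A $$ (i, j))"
      unfolding psd_on_def
    proof
      fix z
      have "0 \<le> quad_form {0..<?n} (\<lambda>i j. A $$ (i, j)) (\<lambda>i. vec ?n z $ i)"
        using L form[of "vec ?n z"] by (metis vec_carrier)
      then show "0 \<le> quad_form {0..<?n} (\<lambda>i j. A $$ (i, j)) z"
        by (subst (asm) quad_form_cong[where y = z]) auto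
    qed
  qed (simp add: form psd_on_def)
  then show ?thesis
    using A sym elems unfolding graph_psd_mats_def psd_mats_def graph_sym_mats_def sym_mats_def
    by auto
qed

lemma graph_map_mat_psd_iff:
  assumes "sym (parcs G)" "A \<in> graph_psd_mats G I"
  shows "graph_map_mat G f A \<in> graph_psd_mats G UNIV
    \<longleftrightarrow> psd_on {0..<graph_size G} (entrywise_on (parcs G) f (\<lambda>i j. A $$ (i, j)))"
proof -
  have "psd_on {0..<graph_size G} (\<lambda>i j. graph_map_mat G f A $$ (i, j))
    \<longleftrightarrow> psd_on {0..<graph_size G} (entrywise_on (parcs G) f (\<lambda>i j. A $$ (i, j)))"
    by (intro psd_on_cong) (auto simp: graph_map_mat_def entrywise_on_def)
  moreover have "A $$ (i, j) = A $$ (j, i)" if "i < graph_size G" "j < graph_size G" for i j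
    using assms(2) that by (auto simp: graph_psd_mats_iff)
  ultimately show ?thesis
    using symD[OF assms(1)] unfolding graph_psd_mats_iff by (auto simp: graph_map_mat_def)
qed

lemma graph_map_mat_preserves_psd:
  fixes I :: "real set" and f :: "real \<Rightarrow> real"
  assumes I: "I \<subseteq> {0..}" "\<forall>x\<in>I. {0..x} \<subseteq> I"
    and f_nonneg: "\<forall>x\<in>I. 0 \<le> f x"
    and f_mult: "\<forall>x\<in>I. \<forall>y\<in>I. (f (sqrt (x * y)))\<^sup>2 \<le> f x * f y"
    and f_super: "\<forall>x\<in>I. \<forall>y\<in>I. x + y \<in> I \<longrightarrow> f x + f y \<le> f (x + y)"
    and E: "sym (parcs G)" and elim: "leaf_eliminable (parcs G) {0..<graph_size G}"
    and A: "A \<in> graph_psd_mats G I"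
  shows "graph_map_mat G f A \<in> graph_psd_mats G UNIV"
  unfolding graph_map_mat_psd_iff[OF E A]
  by (rule entrywise_on_psd[OF I f_nonneg f_mult f_super E _ elim])
    (use A in \<open>auto simp: graph_psd_mats_iff\<close>)

section \<open>Necessity from a cherry\<close>

text \<open>
  The entries at \<open>(c, b)\<close> and \<open>(b, b)\<close> agree.  Both test matrices have this shape, with \<open>s = 0\<close> for the
  one that lives on \<open>{c, a}\<close>.
\<close>

definition cherry_kernel ::
    "'a \<Rightarrow> 'a \<Rightarrow> 'a \<Rightarrow> real \<Rightarrow> real \<Rightarrow> real \<Rightarrow> real \<Rightarrow> 'a \<Rightarrow> 'a \<Rightarrow> real" where
  "cherry_kernel c a b p q r s i j =
    (if (i, j) = (c, c) then p
     else if (i, j) \<in> {(c, a), (a, c)} then q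
     else if (i, j) = (a, a) then r
     else if (i, j) \<in> {(c, b), (b, c), (b, b)} then s else 0)"

definition cherry_form :: "real \<Rightarrow> real \<Rightarrow> real \<Rightarrow> real \<Rightarrow> real \<Rightarrow> real \<Rightarrow> real \<Rightarrow> real" where
  "cherry_form p q r s x y z = p * x\<^sup>2 + 2 * q * x * y + r * y\<^sup>2 + 2 * s * x * z + s * z\<^sup>2"

lemma quad_form_cherry:
  assumes "distinct [c, a, b]"
  shows "quad_form {c, a, b} (cherry_kernel c a b p q r s) z = cherry_form p q r s (z c) (z a) (z b)"
proof -
  have "c \<noteq> a" "a \<noteq> c" "c \<noteq> b" "b \<noteq> c" "a \<noteq> b" "b \<noteq> a"
    using assms by auto
  then show ?thesis
    by (simp add: quad_form_def cherry_kernel_def cherry_form_def power2_eq_square)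
qed

text \<open>
  A kernel supported on a cherry is an admissible matrix of the whole graph, and restricting its
  image to the three vertices of the cherry gives the kernel with \<open>f\<close> applied to the parameters.  The
  entry at \<open>(a, b)\<close> stays zero because \<open>a\<close> and \<open>b\<close> are not adjacent; at the pairs \<open>(c, b)\<close> and
  \<open>(b, b)\<close> the kernel becomes \<open>f s\<close>, also when \<open>s = 0\<close>.
\<close>

lemma cherry_form_preserved:
  assumes E: "sym (parcs G)" "parcs G \<subseteq> {0..<graph_size G} \<times> {0..<graph_size G}"
    and cherry: "cherry (parcs G) c a b"
    and pres: "\<forall>A \<in> graph_psd_mats G I. graph_map_mat G f A \<in> graph_psd_mats G UNIV"
    and I: "0 \<in> I" "p \<in> I" "q \<in> I" "r \<in> I" "s \<in> I"
    and nonneg: "\<And>x y z. 0 \<le> cherry_form p q r s x y z"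
  shows "0 \<le> cherry_form (f p) (f q) (f r) (f s) x y z"
proof -
  let ?n = "graph_size G" and ?V = "{0..<graph_size G}" and ?S = "{c, a, b}"
  let ?k = "cherry_kernel c a b p q r s"
  let ?A = "mat ?n ?n (\<lambda>(i, j). ?k i j)"
  have dist: "distinct [c, a, b]" and arcs: "(c, a) \<in> parcs G" "(c, b) \<in> parcs G" "(a, b) \<notin> parcs G"
    using cherry by (auto simp: cherry_def)
  have arcs': "(a, c) \<in> parcs G" "(b, c) \<in> parcs G" "(b, a) \<notin> parcs G"
    using arcs symD[OF E(1)] by blast+
  have S: "?S \<subseteq> ?V" using arcs E(2) by auto
  have "psd_on ?V ?k"
    unfolding psd_on_def
  proof
    fix z
    have "quad_form ?V ?k z = quad_form ?S ?k z"
      using S by (intro quad_form_supported) (auto simp: cherry_kernel_def)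
    then show "0 \<le> quad_form ?V ?k z"
      using nonneg quad_form_cherry[OF dist] by simp
  qed
  moreover have k_sym: "?k i j = ?k j i" for i j
    unfolding cherry_kernel_def by (intro if_cong) auto
  moreover have k_I: "?k i j \<in> I" for i j
    using I by (simp add: cherry_kernel_def)
  moreover have k_arcs: "?k i j = 0" if "(i, j) \<notin> parcs G" "i \<noteq> j" for i j
    using that arcs arcs' by (auto simp: cherry_kernel_def)
  moreover have "psd_on ?V (\<lambda>i j. ?A $$ (i, j)) \<longleftrightarrow> psd_on ?V ?k"
    by (intro psd_on_cong) auto
  ultimately have A: "?A \<in> graph_psd_mats G I"
    unfolding graph_psd_mats_iff using k_sym k_I k_arcs by simp
  have "psd_on ?V (entrywise_on (parcs G) f (\<lambda>i j. ?A $$ (i, j)))"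
    using pres A graph_map_mat_psd_iff[OF E(1) A] by blast
  then have "psd_on ?S (entrywise_on (parcs G) f (\<lambda>i j. ?A $$ (i, j)))"
    by (rule psd_on_subset) (use S in auto)
  moreover have "entrywise_on (parcs G) f (\<lambda>i j. ?A $$ (i, j)) i j
      = cherry_kernel c a b (f p) (f q) (f r) (f s) i j" if "i \<in> ?S" "j \<in> ?S" for i j
    using that S dist arcs arcs' by (auto simp: entrywise_on_def cherry_kernel_def)
  ultimately have "psd_on ?S (cherry_kernel c a b (f p) (f q) (f r) (f s))"
    using psd_on_cong[of ?S] by blast
  then have "0 \<le> quad_form ?S (cherry_kernel c a b (f p) (f q) (f r) (f s))
      (\<lambda>i. if i = c then x else if i = a then y else z)"
    by (simp add: psd_on_def)
  then show ?thesis using quad_form_cherry[OF dist] dist by simp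
qed

lemma cherry_form_sum_nonneg:
  assumes "0 \<le> x" "0 \<le> y"
  shows "0 \<le> cherry_form (x + y) x x y t u v"
proof -
  have "cherry_form (x + y) x x y t u v = x * (t + u)\<^sup>2 + y * (t + v)\<^sup>2"
    by (simp add: cherry_form_def power2_eq_square algebra_simps)
  then show ?thesis using assms by simp
qed

text \<open>
  For the multiplicative condition the third coordinate is set to zero, which leaves the block on
  \<open>{c, a}\<close> with determinant \<open>f x * f y - (f (sqrt (x * y)))\<^sup>2\<close>.
\<close>

lemma necessary_from_cherry:
  assumes I: "I \<subseteq> {0..}" "\<forall>x\<in>I. {0..x} \<subseteq> I"
    and E: "sym (parcs G)" "parcs G \<subseteq> {0..<graph_size G} \<times> {0..<graph_size G}"
    and cherry: "cherry (parcs G) c a b"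
    and pres: "\<forall>A \<in> graph_psd_mats G I. graph_map_mat G f A \<in> graph_psd_mats G UNIV"
    and x: "x \<in> I" and y: "y \<in> I"
  shows "(f (sqrt (x * y)))\<^sup>2 \<le> f x * f y"
    and "x + y \<in> I \<Longrightarrow> f x + f y \<le> f (x + y)"
proof -
  note transfer = cherry_form_preserved[OF E cherry pres]
  have nonneg: "0 \<le> x" "0 \<le> y" using x y I(1) by auto
  have zero: "0 \<in> I" using I(2) x nonneg by fastforce
  have "sqrt (x * y) \<le> max x y"
    using nonneg by (intro real_le_lsqrt) (auto simp: max_def power2_eq_square intro!: mult_mono)
  then have sqrtI: "sqrt (x * y) \<in> I"
    using I(2) x y nonneg
    by (metis atLeastAtMost_iff max_def mult_nonneg_nonneg real_sqrt_ge_zero subsetD)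
  have "0 \<le> cherry_form x (sqrt (x * y)) y 0 t u v" for t u v
    using binary_form_nonneg_iff[of x "sqrt (x * y)" y] nonneg by (simp add: cherry_form_def)
  then have "0 \<le> f x * t\<^sup>2 + 2 * f (sqrt (x * y)) * t * u + f y * u\<^sup>2" for t u
    using transfer[OF zero x sqrtI y zero, of t u 0] by (simp add: cherry_form_def)
  then show "(f (sqrt (x * y)))\<^sup>2 \<le> f x * f y"
    using binary_form_nonneg_iff by blast
  assume xy: "x + y \<in> I"
  \<comment> \<open>The vector \<open>(1, -1, -1)\<close> spans the null space of the test matrix when \<open>x\<close> and \<open>y\<close> are positive,
      so here positivity has no slack.\<close>
  have "0 \<le> cherry_form (f (x + y)) (f x) (f x) (f y) 1 (- 1) (- 1)"
    by (rule transfer[OF zero xy x x y]) (rule cherry_form_sum_nonneg[OF nonneg])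
  then show "f x + f y \<le> f (x + y)"
    by (simp add: cherry_form_def)
qed

section \<open>The equivalence\<close>

theorem theoremA:
  fixes R :: ereal and I :: "real set" and f :: "real \<Rightarrow> real" and G :: "nat pair_pre_digraph"
  assumes "0 < R"
    and "I = {x. 0 \<le> x \<and> ereal x < R}"
    and "\<And>x. x \<in> I \<Longrightarrow> 0 \<le> f x"
    and "tree_graph G"
    and "3 \<le> graph_size G"
  shows
    "let
       C1 = (\<forall>A \<in> graph_psd_mats G I. graph_map_mat G f A \<in> graph_psd_mats G UNIV);
       C2 = (\<forall>T. tree_graph T \<longrightarrow>
               (\<forall>A \<in> graph_psd_mats T I. graph_map_mat T f A \<in> graph_psd_mats T UNIV));
       C3 = (\<forall>A \<in> graph_psd_mats (path_graph 3) I.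
               graph_map_mat (path_graph 3) f A \<in> graph_psd_mats (path_graph 3) UNIV);
       C4 = ((\<forall>x \<in> I. \<forall>y \<in> I. (f (sqrt (x * y)))\<^sup>2 \<le> f x * f y) \<and>
             (\<forall>x \<in> I. \<forall>y \<in> I. x + y \<in> I \<longrightarrow> f x + f y \<le> f (x + y)))
     in (C1 \<longleftrightarrow> C2) \<and> (C2 \<longleftrightarrow> C3) \<and> (C3 \<longleftrightarrow> C4)"
proof -
  let ?pres = "\<lambda>H. \<forall>A \<in> graph_psd_mats H I. graph_map_mat H f A \<in> graph_psd_mats H UNIV"
  let ?C4 = "(\<forall>x \<in> I. \<forall>y \<in> I. (f (sqrt (x * y)))\<^sup>2 \<le> f x * f y) \<and>
    (\<forall>x \<in> I. \<forall>y \<in> I. x + y \<in> I \<longrightarrow> f x + f y \<le> f (x + y))"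
  have I: "I \<subseteq> {0..}" "\<forall>x\<in>I. {0..x} \<subseteq> I"
    unfolding assms(2) by (auto intro: le_less_trans[of "ereal y" "ereal x" R for x y])
  have f: "\<forall>x\<in>I. 0 \<le> f x"
    using assms(3) by blast
  have necessary: ?C4 if "?pres H" "cherry (parcs H) c a b" "sym (parcs H)"
      "parcs H \<subseteq> {0..<graph_size H} \<times> {0..<graph_size H}" for H c a b
    using necessary_from_cherry[OF I that(3,4,2,1)] by blast
  have sufficient: "?pres H" if "?C4" "sym (parcs H)" "leaf_eliminable (parcs H) {0..<graph_size H}" for H
    using graph_map_mat_preserves_psd[OF I f _ _ that(2,3)] that(1) by blast
  have tree: "sym (parcs T)" "parcs T \<subseteq> {0..<graph_size T} \<times> {0..<graph_size T}"
      "leaf_eliminable (parcs T) {0..<graph_size T}" if "tree_graph T" for T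
  proof -
    have T: "pair_graph T" "pverts T = {0..<graph_size T}"
        "\<not> (\<exists>p. pre_digraph.cycle (with_proj T) p \<and> 3 \<le> length p)"
      using that by (auto simp: tree_graph_def labelled_graph_def)
    interpret pair_graph T by (rule T(1))
    show "sym (parcs T)" using arcs_symmetric by (auto intro: symI)
    show "parcs T \<subseteq> {0..<graph_size T} \<times> {0..<graph_size T}"
      using wellformed' unfolding T(2)[symmetric] by auto
    show "leaf_eliminable (parcs T) {0..<graph_size T}"
      using acyclic_leaf_eliminable[OF T(1,3)] unfolding T(2)[symmetric] .
  qed
  obtain c a b where "cherry (parcs G) c a b"
    using tree_graph_has_cherry[OF assms(4,5)] by blast
  then have 1: "?pres G \<Longrightarrow> ?C4"
    using necessary[of G] tree[OF assms(4)] by blast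
  have 2: "?C4 \<Longrightarrow> (\<forall>T. tree_graph T \<longrightarrow> ?pres T)"
    using sufficient tree by blast
  have P3: "sym (parcs (path_graph 3))" "graph_size (path_graph 3) = 3"
      "parcs (path_graph 3) \<subseteq> {0..<3} \<times> {0..<3}" "cherry (parcs (path_graph 3)) 1 0 2"
    by (auto simp: path_graph_def cherry_def intro: symI)
  have "leaf_eliminable (parcs (path_graph 3)) {0..<3}"
    using path_graph_leaf_eliminable[of 3] by (simp add: path_graph_def)
  then have 3: "?pres (path_graph 3) \<longleftrightarrow> ?C4"
    using necessary[of "path_graph 3"] sufficient[of "path_graph 3"] P3 by metis
  show ?thesis
    unfolding Let_def using 1 2 3 assms(4) by blast
qed

end
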